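(* Let $(H,\rho)$ be a complete CAT(0) space with the geodesic extension property and let $A:H\rightrightarrows TH$ be a monotone vector field with the surjectivity condition. Then $\overline{\operatorname{dom}A}$ is convex.
   Context: Geodesics. In a complete CAT(0) space $(H,\rho)$, $\gamma_{x,y}:[0,1]\to H$ denotes the unique geodesic from $x$ to $y$ parametrized with constant speed $\rho(x,y)$; it is called a zero geodesic if $x=y$. A set $C\subset H$ is convex if $\gamma_{x,y}([0,1])\subset C$ for all $x,y\in C$. For a normalized geodesic $\gamma$ (i.e. parametrized on $[0,1]$ with constant speed), $\zeta(\gamma)=0$ if $\gamma$ is a zero geodesic and $\zeta(\gamma)=1$ otherwise. $H$ has the geodesic extension property if for all $p,q\in H$ there is $\eta:\mathbb{R}\to H$ with $\eta(0)=p$, $\eta(1)=q$ and $\rho(\eta(s),\eta(t))=\rho(p,q)|s-t|$ for all $s,t\in\mathbb{R}$. Tangent spaces. For $q,r\ne p$, the comparison angle $\overline\angle_p(q,r)$ is the angle at $\bar p$ in a Euclidean triangle $\bar p\bar q\bar r$ with the same side lengths as $p,q,r$; set $\overline\angle_p(p,p)=0$ and $\overline\angle_p(p,r)=\overline\angle_p(r,p)=\pi/2$ for $r\neq p$. The Alexandrov angle of geodesics $\gamma_1,\gamma_2$ issuing from $p$ is $\alpha_p(\gamma_1,\gamma_2)=\lim_{s,t\to0^+}\overline\angle_p(\gamma_1(s),\gamma_2(t))$. $S_p$ is the set of normalized geodesics issuing from $p$, modulo the relation $\alpha_p=0$, with induced metric $\angle_p$. $T_pH=([0,\infty)\times S_p)/\!\sim$,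 where $(t_1,\gamma_1)\sim(t_2,\gamma_2)$ iff either $t_1\zeta(\gamma_1)=t_2\zeta(\gamma_2)=0$, or $t_1\zeta(\gamma_1)=t_2\zeta(\gamma_2)>0$ and $\gamma_1=\gamma_2$ in $S_p$. The class of $(t,\gamma)$ is written $t\gamma$, and $\gamma$ stands for $1\gamma$. Put $g_p(t_1\gamma_1,t_2\gamma_2)=t_1t_2\zeta(\gamma_1)\zeta(\gamma_2)\cos\angle_p(\gamma_1,\gamma_2)$. $TH=\bigcup_{p\in H}T_pH$. Vector fields. A vector field is a set-valued map $A:H\rightrightarrows TH$ with $Ap\subset T_pH$ for all $p$ (possibly empty); $\operatorname{dom}A=\{p: Ap\neq\emptyset\}$. $A$ is monotone if $g_p(\eta,\gamma_{p,q})\le -g_q(\nu,\gamma_{q,p})$ whenever $\eta\in Ap$, $\nu\in Aq$. $A$ satisfies the surjectivity condition if for all $t>0$ and $x\in H$ there is $p\in H$ with $t\rho(p,x)\gamma_{p,x}\in Ap$. *)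

theory Defs
  imports "HOL-Analysis.Analysis"
begin

text \<open>
  The space \<open>H\<close> is the universe of a metric type \<open>'a\<close>.  A map \<open>[0,1] \<rightarrow> H\<close> is represented by a
  function on the reals that is \<^const>\<open>extensional\<close> on \<open>{0..1}\<close>, so that equality of such functions
  is equality of maps on \<open>[0,1]\<close>.
\<close>

definition normalized_geodesic :: "(real \<Rightarrow> 'a::metric_space) \<Rightarrow> 'a \<Rightarrow> 'a \<Rightarrow> bool" where
  "normalized_geodesic g x y \<longleftrightarrow>
     g \<in> extensional {0..1} \<and> g 0 = x \<and> g 1 = y \<and>
     (\<forall>s\<in>{0..1}. \<forall>t\<in>{0..1}. dist (g s) (g t) = dist x y * \<bar>s - t\<bar>)"

definition comparison_triangle ::
    "'a::metric_space \<Rightarrow> 'a \<Rightarrow> 'a \<Rightarrow> real^2 \<Rightarrow> real^2 \<Rightarrow> real^2 \<Rightarrow> bool" where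
  "comparison_triangle p q r p' q' r' \<longleftrightarrow>
     dist p' q' = dist p q \<and> dist q' r' = dist q r \<and> dist r' p' = dist r p"

text \<open>
  The comparison inequality is stated for points on two sides sharing a vertex \<open>p\<close>.  As \<open>p\<close>, \<open>q\<close>, \<open>r\<close>
  are arbitrary, this covers every pair of distinct sides of a geodesic triangle; for two points
  on the same side, the inequality is trivially an equality.
\<close>

definition CAT0_space :: "'a::metric_space itself \<Rightarrow> bool" where
  "CAT0_space (_ :: 'a itself) \<longleftrightarrow>
     (\<forall>x y :: 'a. \<exists>g. normalized_geodesic g x y) \<and>
     (\<forall>(p::'a) q r g h p' q' r' s t.
        normalized_geodesic g p q \<longrightarrow> normalized_geodesic h p r \<longrightarrow>
        comparison_triangle p q r p' q' r' \<longrightarrow> s \<in> {0..1} \<longrightarrow> t \<in> {0..1} \<longrightarrow>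
        dist (g s) (h t) \<le>
          dist ((1 - s) *\<^sub>R p' + s *\<^sub>R q') ((1 - t) *\<^sub>R p' + t *\<^sub>R r'))"

definition geodesic_extension_property :: "'a::metric_space itself \<Rightarrow> bool" where
  "geodesic_extension_property (_ :: 'a itself) \<longleftrightarrow>
     (\<forall>p q :: 'a. \<exists>\<eta> :: real \<Rightarrow> 'a. \<eta> 0 = p \<and> \<eta> 1 = q \<and>
        (\<forall>s t. dist (\<eta> s) (\<eta> t) = dist p q * \<bar>s - t\<bar>))"

definition geod :: "'a::metric_space \<Rightarrow> 'a \<Rightarrow> real \<Rightarrow> 'a" where
  "geod x y = (THE g. normalized_geodesic g x y)"

definition geodesically_convex :: "'a::metric_space set \<Rightarrow> bool" where
  "geodesically_convex C \<longleftrightarrow> (\<forall>x\<in>C. \<forall>y\<in>C. geod x y ` {0..1} \<subseteq> C)"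

text \<open>Only meaningful on normalized geodesics, which are constant iff their endpoints agree.\<close>

definition zeta :: "(real \<Rightarrow> 'a) \<Rightarrow> real" where
  "zeta g = (if g 0 = g 1 then 0 else 1)"

definition vector_angle :: "real^2 \<Rightarrow> real^2 \<Rightarrow> real" where
  "vector_angle u v = arccos (u \<bullet> v / (norm u * norm v))"

definition comparison_angle :: "'a::metric_space \<Rightarrow> 'a \<Rightarrow> 'a \<Rightarrow> real" where
  "comparison_angle p q r =
     (if q = p \<and> r = p then 0
      else if q = p \<or> r = p then pi / 2
      else (THE \<theta>. \<exists>p' q' r'. comparison_triangle p q r p' q' r' \<and>
                     \<theta> = vector_angle (q' - p') (r' - p')))"

definition alexandrov_angle ::
    "'a::metric_space \<Rightarrow> (real \<Rightarrow> 'a) \<Rightarrow> (real \<Rightarrow> 'a) \<Rightarrow> real" where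
  "alexandrov_angle p g h =
     Lim (at_right 0 \<times>\<^sub>F at_right 0) (\<lambda>(s, t). comparison_angle p (g s) (h t))"

definition geodesics_from :: "'a::metric_space \<Rightarrow> (real \<Rightarrow> 'a) set" where
  "geodesics_from p = {g. \<exists>x. normalized_geodesic g p x}"

definition direction_rel :: "'a::metric_space \<Rightarrow> ((real \<Rightarrow> 'a) \<times> (real \<Rightarrow> 'a)) set" where
  "direction_rel p =
     {(g, h) \<in> geodesics_from p \<times> geodesics_from p. alexandrov_angle p g h = 0}"

type_synonym 'a direction = "(real \<Rightarrow> 'a) set"

definition direction_space :: "'a::metric_space \<Rightarrow> 'a direction set" where
  "direction_space p = geodesics_from p // direction_rel p"

definition direction :: "'a::metric_space \<Rightarrow> (real \<Rightarrow> 'a) \<Rightarrow> 'a direction" where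
  "direction p g = direction_rel p `` {g}"

text \<open>
  A function on representatives descends to equivalence classes by taking the unique element of
  its image (\<^const>\<open>the_elem\<close>).
\<close>

definition direction_zeta :: "'a direction \<Rightarrow> real" where
  "direction_zeta c = the_elem (zeta ` c)"

definition direction_angle :: "'a::metric_space \<Rightarrow> 'a direction \<Rightarrow> 'a direction \<Rightarrow> real" where
  "direction_angle p c d = the_elem ((\<lambda>(g, h). alexandrov_angle p g h) ` (c \<times> d))"

definition tangent_rel ::
    "'a::metric_space \<Rightarrow> ((real \<times> 'a direction) \<times> (real \<times> 'a direction)) set" where
  "tangent_rel p =
     {((t1, c1), (t2, c2)). t1 \<ge> 0 \<and> t2 \<ge> 0 \<and> c1 \<in> direction_space p \<and> c2 \<in> direction_space p \<and>
        (t1 * direction_zeta c1 = 0 \<and> t2 * direction_zeta c2 = 0 \<or>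
         t1 * direction_zeta c1 = t2 * direction_zeta c2 \<and> t1 * direction_zeta c1 > 0 \<and> c1 = c2)}"

type_synonym 'a tangent = "(real \<times> 'a direction) set"

definition tangent_space :: "'a::metric_space \<Rightarrow> 'a tangent set" where
  "tangent_space p = ({0..} \<times> direction_space p) // tangent_rel p"

text \<open>The tangent vector \<open>t\<gamma>\<close> at \<open>p\<close>.\<close>

definition tangent_vector :: "'a::metric_space \<Rightarrow> real \<Rightarrow> (real \<Rightarrow> 'a) \<Rightarrow> 'a tangent" where
  "tangent_vector p t g = tangent_rel p `` {(t, direction p g)}"

definition tangent_product :: "'a::metric_space \<Rightarrow> 'a tangent \<Rightarrow> 'a tangent \<Rightarrow> real" where
  "tangent_product p u v =
     the_elem ((\<lambda>((t1, c1), (t2, c2)).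
       t1 * t2 * direction_zeta c1 * direction_zeta c2 * cos (direction_angle p c1 c2)) ` (u \<times> v))"

text \<open>
  The tangent spaces at distinct points are disjoint (an element of either determines the starting
  point of its geodesics), so the tangent bundle is just their union.
\<close>

definition tangent_bundle :: "'a::metric_space tangent set" where
  "tangent_bundle = (\<Union>p. tangent_space p)"

definition vector_field :: "('a::metric_space \<Rightarrow> 'a tangent set) \<Rightarrow> bool" where
  "vector_field A \<longleftrightarrow> (\<forall>p. A p \<subseteq> tangent_bundle \<and> A p \<subseteq> tangent_space p)"

definition field_dom :: "('a::metric_space \<Rightarrow> 'a tangent set) \<Rightarrow> 'a set" where
  "field_dom A = {p. A p \<noteq> {}}"

definition monotone_field :: "('a::metric_space \<Rightarrow> 'a tangent set) \<Rightarrow> bool" where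
  "monotone_field A \<longleftrightarrow>
     (\<forall>p q. \<forall>\<eta>\<in>A p. \<forall>\<nu>\<in>A q.
        tangent_product p \<eta> (tangent_vector p 1 (geod p q))
          \<le> - tangent_product q \<nu> (tangent_vector q 1 (geod q p)))"

definition surjectivity_condition :: "('a::metric_space \<Rightarrow> 'a tangent set) \<Rightarrow> bool" where
  "surjectivity_condition A \<longleftrightarrow>
     (\<forall>t>0. \<forall>x. \<exists>p. tangent_vector p (t * dist p x) (geod p x) \<in> A p)"

end

theory Submission
  imports Defs
begin

text \<open>
  For \<open>x\<close> on the geodesic between \<open>q\<^sub>0, q\<^sub>1 \<in> dom A\<close>, let \<open>p\<close> be the resolvent point with
  \<open>t \<rho>(p,x) \<gamma>\<^bsub>p,x\<^esub> \<in> A p\<close>.  Since angles are at most comparison angles, monotonicity gives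
  \<open>\<rho>(p,x)\<^sup>2 + \<rho>(p,q\<^sub>i)\<^sup>2 \<le> \<rho>(x,q\<^sub>i)\<^sup>2 + (2 C\<^sub>i / t) \<rho>(p,q\<^sub>i)\<close>.  The convex combination of these two
  estimates, compared with the CN inequality at \<open>p\<close>, yields \<open>\<rho>(p,x) \<rightarrow> 0\<close> as \<open>t \<rightarrow> \<infinity>\<close>.  The CN
  inequality also shows that geodesics depend continuously on their endpoints, which passes the
  convexity to the closure.
\<close>

section \<open>Comparison angles\<close>

text \<open>The vertex \<open>p\<close> goes to the origin and \<open>q\<close> to the first axis;
  the law of cosines then fixes the first coordinate \<open>x\<close> of \<open>r'\<close>. The
  triangle inequalities give \<open>\<bar>x\<bar> \<le> b\<close>, so the second coordinate is
  real.\<close>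

lemma comparison_triangle_exists:
  fixes p q r :: "'a::metric_space"
  obtains q' r' where "comparison_triangle p q r 0 q' r'"
proof -
  define a where "a = dist p q"
  define b where "b = dist p r"
  define c where "c = dist q r"
  \<comment> \<open>If \<open>a = 0\<close> then \<open>b = c\<close> and \<open>x\<close> is not
    determined; the choice \<open>x = b\<close> puts \<open>r'\<close> on the axis.\<close>
  define x where "x = (if a = 0 then b else (a\<^sup>2 + b\<^sup>2 - c\<^sup>2) / (2 * a))"
  define y where "y = sqrt (b\<^sup>2 - x\<^sup>2)"
  have nonneg: "a \<ge> 0" "b \<ge> 0" "c \<ge> 0"
    by (auto simp: a_def b_def c_def)
  have tri: "a \<le> b + c" "b \<le> a + c" "c \<le> a + b"
    unfolding a_def b_def c_def
    by (metis dist_commute dist_triangle add.commute)+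
  have x: "a\<^sup>2 + b\<^sup>2 - c\<^sup>2 = 2 * a * x"
    using tri nonneg by (auto simp: x_def)
  have "\<bar>x\<bar> \<le> b"
  proof (cases "a = 0")
    case False
    have "(a - b)\<^sup>2 \<le> c\<^sup>2" "c\<^sup>2 \<le> (a + b)\<^sup>2"
      using tri nonneg by (auto simp: abs_le_square_iff[symmetric])
    then have "a * x \<le> a * b" "a * (- x) \<le> a * b"
      using x by (auto simp: power2_eq_square algebra_simps)
    then have "x \<le> b" "- x \<le> b"
      using False nonneg by (auto intro: mult_left_le_imp_le[of a])
    then show ?thesis
      by (simp add: abs_le_iff)
  qed (use nonneg x_def in auto)
  then have xy: "x\<^sup>2 + y\<^sup>2 = b\<^sup>2"
    using nonneg by (simp add: y_def abs_le_square_iff[symmetric])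
  define q' :: "real^2" where "q' = vector [a, 0]"
  define r' :: "real^2" where "r' = vector [x, y]"
  have "dist 0 q' = a" "dist r' 0 = b"
    using nonneg xy by (auto simp: q'_def r'_def norm_vec_def L2_set_def sum_2)
  moreover have "dist q' r' = c"
  proof -
    have "(a - x)\<^sup>2 + y\<^sup>2 = c\<^sup>2"
      using x xy by (simp add: power2_diff)
    then show ?thesis
      using nonneg by (simp add: q'_def r'_def dist_vec_def L2_set_def sum_2 dist_real_def)
  qed
  ultimately have "comparison_triangle p q r 0 q' r'"
    by (simp add: comparison_triangle_def a_def b_def c_def dist_commute)
  then show ?thesis
    by (rule that)
qed

text \<open>The cosine of the comparison angle by the law of cosines, an explicit function of the
  distances that can be estimated without \<open>arccos\<close>. It is 0 when \<open>q = p\<close>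
  or \<open>r = p\<close>, because division by 0 gives 0.\<close>

definition comparison_cos :: "'a::metric_space \<Rightarrow> 'a \<Rightarrow> 'a \<Rightarrow> real" where
  "comparison_cos p q r =
     ((dist p q)\<^sup>2 + (dist p r)\<^sup>2 - (dist q r)\<^sup>2) / (2 * dist p q * dist p r)"

lemma inner_eq_dist:
  fixes p q r :: "'a::real_inner"
  shows "(q - p) \<bullet> (r - p) = ((dist p q)\<^sup>2 + (dist p r)\<^sup>2 - (dist q r)\<^sup>2) / 2"
  by (simp add: dist_norm power2_norm_eq_inner algebra_simps inner_commute)

lemma comparison_cos_eq_inner:
  assumes "comparison_triangle p q r p' q' r'"
  shows "comparison_cos p q r = (q' - p') \<bullet> (r' - p') / (norm (q' - p') * norm (r' - p'))"
  using assms unfolding inner_eq_dist comparison_triangle_def comparison_cos_def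
  by (simp add: dist_norm norm_minus_commute dist_commute)

text \<open>Cauchy-Schwarz in a comparison triangle.\<close>

lemma comparison_cos_bounds: "\<bar>comparison_cos p q r\<bar> \<le> 1"
proof -
  obtain q' r' where "comparison_triangle p q r 0 q' r'"
    by (rule comparison_triangle_exists)
  then have "comparison_cos p q r = (q' - 0) \<bullet> (r' - 0) / (norm (q' - 0) * norm (r' - 0))"
    by (rule comparison_cos_eq_inner)
  moreover have "\<bar>q' \<bullet> r'\<bar> \<le> norm q' * norm r'"
    by (rule Cauchy_Schwarz_ineq2)
  ultimately show ?thesis
    by (auto simp: divide_le_eq_1)
qed

text \<open>A comparison triangle exists, and all of them yield the same angle since its cosine
  depends on the three distances only; so the definite description denotes.\<close>

lemma comparison_angle_eq_arccos:
  assumes "q \<noteq> p" "r \<noteq> p"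
  shows "comparison_angle p q r = arccos (comparison_cos p q r)"
proof -
  obtain q' r' where "comparison_triangle p q r 0 q' r'"
    by (rule comparison_triangle_exists)
  moreover have "vector_angle (q' - p') (r' - p') = arccos (comparison_cos p q r)"
    if "comparison_triangle p q r p' q' r'" for p' q' r'
    by (simp add: vector_angle_def comparison_cos_eq_inner[OF that])
  ultimately have "(THE \<theta>. \<exists>p' q' r'. comparison_triangle p q r p' q' r' \<and>
                     \<theta> = vector_angle (q' - p') (r' - p')) = arccos (comparison_cos p q r)"
    by (intro the_equality) metis+
  then show ?thesis
    using assms by (simp add: comparison_angle_def)
qed

section \<open>Geodesics\<close>

lemma normalized_geodesicD:
  assumes "normalized_geodesic g x y"
  shows "g 0 = x" "g 1 = y"
    and "s \<in> {0..1} \<Longrightarrow> t \<in> {0..1} \<Longrightarrow> dist (g s) (g t) = dist x y * \<bar>s - t\<bar>"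
    and "t \<in> {0..1} \<Longrightarrow> dist x (g t) = dist x y * t"
    and "t \<in> {0..1} \<Longrightarrow> dist y (g t) = dist x y * (1 - t)"
proof -
  show *: "g 0 = x" "g 1 = y"
    using assms by (auto simp: normalized_geodesic_def)
  show dist: "dist (g s) (g t) = dist x y * \<bar>s - t\<bar>" if "s \<in> {0..1}" "t \<in> {0..1}" for s t
    using assms that by (auto simp: normalized_geodesic_def)
  show "dist x (g t) = dist x y * t" if "t \<in> {0..1}"
    using dist[of 0 t] that * by simp
  show "dist y (g t) = dist x y * (1 - t)" if "t \<in> {0..1}"
    using dist[of 1 t] that * by simp
qed

lemma normalized_geodesic_ext:
  assumes "normalized_geodesic g x y" "normalized_geodesic h x' y'"
    and "\<And>t. t \<in> {0..1} \<Longrightarrow> g t = h t"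
  shows "g = h"
  using assms by (auto simp: normalized_geodesic_def intro: extensionalityI)

text \<open>Allows the CN inequality to be applied to the piece of \<open>g\<close> between
  \<open>x\<close> and \<open>g s\<close>.\<close>

lemma normalized_geodesic_initial_segment:
  assumes g: "normalized_geodesic g x y" and s: "s \<in> {0..1}"
  shows "normalized_geodesic (restrict (\<lambda>u. g (s * u)) {0..1}) x (g s)"
proof -
  have *: "dist (g (s * u)) (g (s * v)) = dist x (g s) * \<bar>u - v\<bar>" if "u \<in> {0..1}" "v \<in> {0..1}" for u v
  proof -
    have "s * u \<in> {0..1}" "s * v \<in> {0..1}"
      using that s by (auto intro: mult_le_one)
    then have "dist (g (s * u)) (g (s * v)) = dist x y * \<bar>s * u - s * v\<bar>"
      by (rule normalized_geodesicD[OF g])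
    also have "\<dots> = dist x (g s) * \<bar>u - v\<bar>"
      using s by (simp add: normalized_geodesicD(4)[OF g] abs_mult flip: right_diff_distrib)
    finally show ?thesis .
  qed
  then show ?thesis
    by (auto simp: normalized_geodesic_def normalized_geodesicD(1)[OF g])
qed

lemma geodesics_fromE:
  assumes "g \<in> geodesics_from p"
  shows "normalized_geodesic g p (g 1)"
  using assms by (auto simp: geodesics_from_def normalized_geodesicD)

section \<open>Zero and nonzero geodesics\<close>

lemma zeta_cases: "zeta g = 0 \<or> zeta g = 1"
  by (simp add: zeta_def)

lemma zeta_geodesic:
  assumes "g \<in> geodesics_from p"
  shows "zeta g = (if g 1 = p then 0 else 1)"
  using normalized_geodesicD(1)[OF geodesics_fromE[OF assms]] by (auto simp: zeta_def)

lemma zero_geodesic_const: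
  assumes "g \<in> geodesics_from p" "zeta g = 0" "t \<in> {0..1}"
  shows "g t = p"
  using normalized_geodesicD(4)[OF geodesics_fromE[OF assms(1)] assms(3)] assms
  by (auto simp: zeta_geodesic split: if_splits)

lemma nonzero_geodesic_ne:
  assumes "g \<in> geodesics_from p" "zeta g = 1" "0 < t" "t \<le> 1"
  shows "g t \<noteq> p"
  using normalized_geodesicD(4)[OF geodesics_fromE[OF assms(1)], of t] assms
  by (auto simp: zeta_geodesic split: if_splits)

section \<open>The CN inequality, uniqueness of geodesics and their dependence on endpoints\<close>

locale cat0 =
  fixes type :: "'a::metric_space itself"
  assumes cat0: "CAT0_space type"
begin

lemma cat0_ineq:
  fixes p q r :: 'a
  assumes "normalized_geodesic g p q" "normalized_geodesic h p r"
    "comparison_triangle p q r p' q' r'" "s \<in> {0..1}" "t \<in> {0..1}"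
  shows "dist (g s) (h t) \<le> dist ((1 - s) *\<^sub>R p' + s *\<^sub>R q') ((1 - t) *\<^sub>R p' + t *\<^sub>R r')"
proof -
  \<comment> \<open>\<open>CAT0_space\<close> does not inspect its argument, so the locale parameter
    may be exchanged for \<open>TYPE('a)\<close>.\<close>
  have "CAT0_space TYPE('a)"
    using cat0 by (simp add: CAT0_space_def)
  then show ?thesis
    using assms unfolding CAT0_space_def by blast
qed

lemma geodesic_exists: "\<exists>g. normalized_geodesic g x (y :: 'a)"
  using cat0 by (simp add: CAT0_space_def)

text \<open>The comparison inequality between a point of the side from \<open>p\<close> to
  \<open>q\<close> and the vertex \<open>r\<close>; in the plane the corresponding distance is given
  exactly by Stewart's identity.\<close>

lemma CN_inequality:
  fixes p q r :: 'a
  assumes g: "normalized_geodesic g p q" and l: "l \<in> {0..1}"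
  shows "(dist r (g l))\<^sup>2 \<le> (1 - l) * (dist r p)\<^sup>2 + l * (dist r q)\<^sup>2 - l * (1 - l) * (dist p q)\<^sup>2"
proof -
  obtain h where h: "normalized_geodesic h p r"
    using geodesic_exists by blast
  obtain q' r' where tri: "comparison_triangle p q r 0 q' r'"
    by (rule comparison_triangle_exists)
  have "dist (g l) (h 1) \<le> dist ((1 - l) *\<^sub>R 0 + l *\<^sub>R q') ((1 - 1) *\<^sub>R 0 + 1 *\<^sub>R r')"
    using l by (intro cat0_ineq[OF g h tri]) auto
  then have "dist r (g l) \<le> norm (l *\<^sub>R q' - r')"
    by (simp add: normalized_geodesicD(2)[OF h] dist_norm dist_commute)
  then have "(dist r (g l))\<^sup>2 \<le> (norm (l *\<^sub>R q' - r'))\<^sup>2"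
    by (intro power_mono) auto
  also have "\<dots> = (1 - l) * (norm r')\<^sup>2 + l * (norm (q' - r'))\<^sup>2 - l * (1 - l) * (norm q')\<^sup>2"
    unfolding power2_norm_eq_inner by (simp add: algebra_simps inner_commute power2_eq_square)
  finally show ?thesis
    using tri by (simp add: comparison_triangle_def dist_norm dist_commute)
qed

text \<open>The CN inequality for \<open>g\<close>, seen from the point \<open>h t\<close>, bounds
  their squared distance by a multiple of
  \<open>(1 - t) * t^2 + t * (1 - t)^2 - t * (1 - t)\<close>, which is 0.\<close>

lemma geodesic_unique:
  fixes x y :: 'a
  assumes g: "normalized_geodesic g x y" and h: "normalized_geodesic h x y"
  shows "g = h"
proof (rule normalized_geodesic_ext[OF g h])
  fix t :: real assume t: "t \<in> {0..1}"
  have "(dist (h t) (g t))\<^sup>2 \<le>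
      (1 - t) * (dist (h t) x)\<^sup>2 + t * (dist (h t) y)\<^sup>2 - t * (1 - t) * (dist x y)\<^sup>2"
    by (rule CN_inequality[OF g t])
  also have "\<dots> = 0"
    using t by (simp add: dist_commute[of "h t"] normalized_geodesicD(4,5)[OF h])
      (simp add: power2_eq_square algebra_simps)
  finally show "g t = h t"
    by simp
qed

lemma normalized_geodesic_geod: "normalized_geodesic (geod x y) x (y :: 'a)"
  unfolding geod_def using geodesic_exists geodesic_unique by (metis theI')

lemma geod_in_geodesics_from: "geod x y \<in> geodesics_from (x :: 'a)"
  using normalized_geodesic_geod by (auto simp: geodesics_from_def)

text \<open>The CN inequality for the geodesics from \<open>X n\<close> to \<open>Y n\<close>, seen
  from the limit point \<open>m\<close>, bounds the squared distance by \<open>f n\<close>; the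
  limit of \<open>f\<close> vanishes by the identity behind uniqueness.\<close>

lemma tendsto_geod:
  fixes x y :: 'a
  assumes X: "X \<longlonglongrightarrow> x" and Y: "Y \<longlonglongrightarrow> y" and u: "u \<in> {0..1}"
  shows "(\<lambda>n. geod (X n) (Y n) u) \<longlonglongrightarrow> geod x y u"
proof -
  define m where "m = geod x y u"
  define f where "f n = (1 - u) * (dist m (X n))\<^sup>2 + u * (dist m (Y n))\<^sup>2
      - u * (1 - u) * (dist (X n) (Y n))\<^sup>2" for n
  have "f \<longlonglongrightarrow> (1 - u) * (dist m x)\<^sup>2 + u * (dist m y)\<^sup>2 - u * (1 - u) * (dist x y)\<^sup>2"
    unfolding f_def by (intro tendsto_intros X Y)
  also have "(1 - u) * (dist m x)\<^sup>2 + u * (dist m y)\<^sup>2 - u * (1 - u) * (dist x y)\<^sup>2 = 0"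
    using u by (simp add: m_def dist_commute[of "geod x y u"]
        normalized_geodesicD(4,5)[OF normalized_geodesic_geod])
      (simp add: power2_eq_square algebra_simps)
  finally have f: "f \<longlonglongrightarrow> 0" .
  have "(\<lambda>n. (dist m (geod (X n) (Y n) u))\<^sup>2) \<longlonglongrightarrow> 0"
    by (rule tendsto_sandwich[OF _ _ tendsto_const f])
      (auto simp: f_def intro!: always_eventually CN_inequality[OF normalized_geodesic_geod u])
  then have "(\<lambda>n. sqrt ((dist m (geod (X n) (Y n) u))\<^sup>2)) \<longlonglongrightarrow> sqrt 0"
    by (rule tendsto_real_sqrt)
  then show ?thesis
    unfolding m_def[symmetric] by (subst tendsto_dist_iff) (simp add: dist_commute)
qed

section \<open>Alexandrov angles\<close>

text \<open>Comparison angles shrink as a point moves towards \<open>p\<close>: the CN inequality on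
  the segment from \<open>p\<close> to \<open>g s\<close> bounds the distance from \<open>r\<close>
  to \<open>g s'\<close>, and the law of cosines turns this into a bound on the cosine.\<close>

lemma comparison_cos_antimono_left:
  fixes p r :: 'a
  assumes g: "g \<in> geodesics_from p" "zeta g = 1" and s: "0 < s'" "s' \<le> s" "s \<le> 1" and r: "r \<noteq> p"
  shows "comparison_cos p (g s) r \<le> comparison_cos p (g s') r"
proof -
  define l where "l = s' / s"
  define a b c where "a = dist p (g s)" and "b = dist p r" and "c = dist r (g s)"
  have l: "0 < l" "l \<le> 1" and sl: "s * l = s'"
    using s by (auto simp: l_def field_simps)
  note gg = normalized_geodesic_initial_segment[OF geodesics_fromE[OF g(1)], of s]
  have "(dist r (restrict (\<lambda>u. g (s * u)) {0..1} l))\<^sup>2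
      \<le> (1 - l) * (dist r p)\<^sup>2 + l * (dist r (g s))\<^sup>2 - l * (1 - l) * (dist p (g s))\<^sup>2"
    using s l by (intro CN_inequality gg) auto
  then have CN: "(dist r (g s'))\<^sup>2 \<le> (1 - l) * b\<^sup>2 + l * c\<^sup>2 - l * (1 - l) * a\<^sup>2"
    using l by (simp add: sl a_def b_def c_def dist_commute)
  have a: "a > 0" and b: "b > 0"
    using nonzero_geodesic_ne[OF g, of s] s r by (auto simp: a_def b_def)
  have a': "dist p (g s') = l * a"
    using normalized_geodesicD(4)[OF geodesics_fromE[OF g(1)], of s]
      normalized_geodesicD(4)[OF geodesics_fromE[OF g(1)], of s'] s by (simp add: a_def l_def)
  \<comment> \<open>Expanding by \<open>l\<close> gives both cosines the same denominator.\<close>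
  have "comparison_cos p (g s) r = (l * (a\<^sup>2 + b\<^sup>2 - c\<^sup>2)) / (2 * (l * a) * b)"
    using l unfolding comparison_cos_def a_def b_def c_def dist_commute[of r "g s"] by simp
  also have "\<dots> \<le> ((l * a)\<^sup>2 + b\<^sup>2 - (dist r (g s'))\<^sup>2) / (2 * (l * a) * b)"
    using CN a b l by (intro divide_right_mono) (auto simp: power2_eq_square algebra_simps)
  also have "\<dots> = comparison_cos p (g s') r"
    unfolding comparison_cos_def a' b_def dist_commute[of r "g s'"] ..
  finally show ?thesis .
qed

lemma comparison_cos_commute: "comparison_cos p q r = comparison_cos p r q"
  by (simp add: comparison_cos_def dist_commute mult_ac add_ac)

lemma comparison_cos_antimono:
  fixes p :: 'a
  assumes g: "g \<in> geodesics_from p" "zeta g = 1" and h: "h \<in> geodesics_from p" "zeta h = 1"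
    and s: "0 < s'" "s' \<le> s" "s \<le> 1" and t: "0 < t'" "t' \<le> t" "t \<le> 1"
  shows "comparison_cos p (g s) (h t) \<le> comparison_cos p (g s') (h t')"
proof -
  have "comparison_cos p (g s) (h t) \<le> comparison_cos p (g s') (h t)"
    using comparison_cos_antimono_left[OF g s] nonzero_geodesic_ne[OF h, of t] t by auto
  also have "\<dots> \<le> comparison_cos p (g s') (h t')"
    using comparison_cos_antimono_left[OF h t] nonzero_geodesic_ne[OF g, of s'] s
    by (auto simp: comparison_cos_commute[of p "g s'"])
  finally show ?thesis .
qed

section \<open>The Alexandrov angle as a limit\<close>

lemma eventually_at_right_0: "0 < b \<Longrightarrow> eventually (\<lambda>s. 0 < s \<and> s \<le> b) (at_right (0::real))"
  by (auto simp: eventually_at_right_field intro!: exI[of _ b])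

lemma eventually_prod_at_right_0:
  assumes "0 < b" "0 < c"
  shows "eventually (\<lambda>(s, t). 0 < s \<and> s \<le> b \<and> 0 < t \<and> t \<le> c) (at_right (0::real) \<times>\<^sub>F at_right (0::real))"
  using eventually_prodI[OF eventually_at_right_0[OF assms(1)] eventually_at_right_0[OF assms(2)]]
  by (simp add: case_prod_unfold conj_assoc)

lemma prod_at_right_ne_bot: "at_right (0::real) \<times>\<^sub>F at_right (0::real) \<noteq> bot"
  by (simp add: prod_filter_eq_bot)

lemma alexandrov_angleI:
  assumes "((\<lambda>(s, t). comparison_angle p (g s) (h t)) \<longlongrightarrow> \<theta>) (at_right 0 \<times>\<^sub>F at_right 0)"
  shows "alexandrov_angle p g h = \<theta>"
  unfolding alexandrov_angle_def by (rule tendsto_Lim[OF prod_at_right_ne_bot assms])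

text \<open>By monotonicity the comparison cosines converge to their supremum \<open>L\<close> over
  all parameters in \<open>(0,1]\<close>. The value at \<open>(1, 1)\<close> is at most
  \<open>L\<close>, so the Alexandrov angle is at most the comparison angle.\<close>

lemma alexandrov_angle_nonzero:
  fixes p :: 'a
  assumes g: "g \<in> geodesics_from p" "zeta g = 1" and h: "h \<in> geodesics_from p" "zeta h = 1"
  shows tendsto_comparison_cos: "((\<lambda>(s, t). comparison_cos p (g s) (h t))
            \<longlongrightarrow> cos (alexandrov_angle p g h)) (at_right 0 \<times>\<^sub>F at_right 0)"
    and alexandrov_angle_bounds: "alexandrov_angle p g h \<in> {0..pi}"
    and comparison_cos_le_cos_alexandrov_angle:
      "comparison_cos p (g 1) (h 1) \<le> cos (alexandrov_angle p g h)"
proof -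
  let ?F = "at_right (0::real) \<times>\<^sub>F at_right (0::real)"
  define f where "f = (\<lambda>(s, t). comparison_cos p (g s) (h t))"
  define I where "I = {0<..1::real} \<times> {0<..1::real}"
  have f1: "\<bar>f z\<bar> \<le> 1" for z
    by (simp add: f_def comparison_cos_bounds split: prod.split)
  have bdd: "bdd_above (f ` I)"
    using f1 by (intro bdd_aboveI[of _ 1]) (auto simp: abs_le_iff)
  define L where "L = (SUP z\<in>I. f z)"
  have fL: "f z \<le> L" if "z \<in> I" for z
    unfolding L_def using that bdd by (rule cSUP_upper)
  have one: "(1, 1) \<in> I"
    by (auto simp: I_def)
  have "L \<le> 1"
    unfolding L_def using one f1 by (intro cSUP_least) (auto simp: abs_le_iff)
  moreover have "- 1 \<le> L"
    using fL[OF one] f1[of "(1, 1)"] by simp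
  ultimately have L: "\<bar>L\<bar> \<le> 1"
    by simp
  have lim: "(f \<longlongrightarrow> L) ?F"
  proof (rule order_tendstoI)
    \<comment> \<open>Some pair already has a value above \<open>y\<close>; monotonicity passes this
      on to all pairs closer to 0.\<close>
    fix y assume "y < L"
    then obtain s t where st: "(s, t) \<in> I" "y < f (s, t)"
      using less_cSUP_iff[OF _ bdd, of y] one unfolding L_def by (metis empty_iff surj_pair)
    then have "0 < s" "s \<le> 1" "0 < t" "t \<le> 1"
      by (auto simp: I_def)
    from eventually_prod_at_right_0[OF this(1,3)] show "\<forall>\<^sub>F z in ?F. y < f z"
    proof eventually_elim
      case (elim z)
      then have "f (s, t) \<le> f z"
        using st(1) unfolding f_def I_def
        by (auto intro!: comparison_cos_antimono[OF g h])
      with st(2) show ?case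
        by simp
    qed
  next
    fix y assume "L < y"
    have "\<forall>\<^sub>F z in ?F. z \<in> I"
      using eventually_prod_at_right_0[OF zero_less_one zero_less_one]
      by eventually_elim (auto simp: I_def)
    then show "\<forall>\<^sub>F z in ?F. f z < y"
      by eventually_elim (use fL \<open>L < y\<close> in force)
  qed
  \<comment> \<open>Continuity of \<open>arccos\<close> on \<open>[-1,1]\<close> carries the limit
    from cosines to angles.\<close>
  have "((\<lambda>z. arccos (f z)) \<longlongrightarrow> arccos L) ?F"
    using L f1 by (intro continuous_on_tendsto_compose[OF continuous_on_arccos' lim])
      (auto simp: abs_le_iff intro!: always_eventually)
  moreover have "\<forall>\<^sub>F z in ?F. arccos (f z) = (\<lambda>(s, t). comparison_angle p (g s) (h t)) z"
    using eventually_prod_at_right_0[OF zero_less_one zero_less_one]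
    by eventually_elim
      (auto simp: f_def nonzero_geodesic_ne[OF g] nonzero_geodesic_ne[OF h] comparison_angle_eq_arccos)
  ultimately have "((\<lambda>(s, t). comparison_angle p (g s) (h t)) \<longlongrightarrow> arccos L) ?F"
    by (rule Lim_transform_eventually)
  then have angle: "alexandrov_angle p g h = arccos L"
    by (rule alexandrov_angleI)
  have cos: "cos (alexandrov_angle p g h) = L"
    using L by (simp add: angle cos_arccos_abs)
  show "((\<lambda>(s, t). comparison_cos p (g s) (h t)) \<longlongrightarrow> cos (alexandrov_angle p g h)) ?F"
    using lim by (simp add: cos f_def)
  show "alexandrov_angle p g h \<in> {0..pi}"
    using L by (auto simp: angle abs_le_iff intro: arccos_lbound arccos_ubound)
  show "comparison_cos p (g 1) (h 1) \<le> cos (alexandrov_angle p g h)"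
    using fL[OF one] by (simp add: cos f_def)
qed

text \<open>A zero geodesic stays at \<open>p\<close> and a nonzero one leaves it at once, so for
  parameters in \<open>(0,1]\<close> the comparison angle is constant, with the value set by
  convention.\<close>

lemma alexandrov_angle_zero:
  assumes g: "g \<in> geodesics_from p" and h: "h \<in> geodesics_from p" and "zeta g = 0 \<or> zeta h = 0"
  shows "alexandrov_angle p g h = (if zeta g = 0 \<and> zeta h = 0 then 0 else pi / 2)"
proof (rule alexandrov_angleI, rule tendsto_eventually)
  show "\<forall>\<^sub>F z in at_right 0 \<times>\<^sub>F at_right 0. (case z of (s, t) \<Rightarrow> comparison_angle p (g s) (h t)) =
      (if zeta g = 0 \<and> zeta h = 0 then 0 else pi / 2)"
    using eventually_prod_at_right_0[OF zero_less_one zero_less_one]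
  proof eventually_elim
    case (elim z)
    obtain s t where z: "z = (s, t)" by (cases z)
    have st: "0 < s" "s \<le> 1" "0 < t" "t \<le> 1"
      using elim by (auto simp: z)
    have "g s = p \<longleftrightarrow> zeta g = 0" "h t = p \<longleftrightarrow> zeta h = 0"
      using zeta_cases[of g] zeta_cases[of h] st
        zero_geodesic_const[OF g, of s] nonzero_geodesic_ne[OF g, of s]
        zero_geodesic_const[OF h, of t] nonzero_geodesic_ne[OF h, of t] by auto
    then show ?case
      using assms(3) by (auto simp: z comparison_angle_def)
  qed
qed

text \<open>
  The limit depends on the metric along unit-speed reparametrizations only, so the triangle
  inequality for \<open>dist\<close> carries over to it; this replaces the triangle inequality for angles.
\<close>

lemma tendsto_chord:
  fixes p :: 'a
  assumes g: "g \<in> geodesics_from p" "zeta g = 1" and h: "h \<in> geodesics_from p" "zeta h = 1"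
  shows "((\<lambda>t. dist (g (t / dist p (g 1))) (h (t / dist p (h 1))) / t)
            \<longlongrightarrow> sqrt (2 - 2 * cos (alexandrov_angle p g h))) (at_right 0)"
proof -
  \<comment> \<open>These are the speeds of \<open>g\<close> and \<open>h\<close>; at parameters
    \<open>t / a\<close> and \<open>t / b\<close> both points lie at distance \<open>t\<close> from
    \<open>p\<close>.\<close>
  define a b where "a = dist p (g 1)" and "b = dist p (h 1)"
  have ab: "a > 0" "b > 0"
    using nonzero_geodesic_ne[OF g, of 1] nonzero_geodesic_ne[OF h, of 1] by (auto simp: a_def b_def)
  let ?D = "\<lambda>t. dist (g (t / a)) (h (t / b))"
  have div: "filterlim (\<lambda>t. t / c) (at_right 0) (at_right 0)" if "c > 0" for c :: real
    unfolding filterlim_at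
  proof
    show "\<forall>\<^sub>F t in at_right 0. t / c \<in> {0<..} \<and> t / c \<noteq> 0"
      using eventually_at_right_0[OF zero_less_one] by eventually_elim (use that in auto)
    show "((\<lambda>t. t / c) \<longlongrightarrow> 0) (at_right 0)"
      using that by (auto intro!: tendsto_eq_intros)
  qed
  \<comment> \<open>The limit over pairs is restricted to the path
    \<open>(t / a, t / b)\<close>.\<close>
  have "((\<lambda>t. comparison_cos p (g (t / a)) (h (t / b))) \<longlongrightarrow> cos (alexandrov_angle p g h)) (at_right 0)"
    using filterlim_compose[OF tendsto_comparison_cos[OF g h] filterlim_Pair[OF div div]] ab by simp
  then have lim: "((\<lambda>t. sqrt (2 - 2 * comparison_cos p (g (t / a)) (h (t / b))))
      \<longlongrightarrow> sqrt (2 - 2 * cos (alexandrov_angle p g h))) (at_right 0)"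
    by (intro tendsto_intros)
  have "\<forall>\<^sub>F t in at_right 0. 0 < t \<and> t \<le> min a b"
    using ab by (intro eventually_at_right_0) auto
  then have "\<forall>\<^sub>F t in at_right 0. sqrt (2 - 2 * comparison_cos p (g (t / a)) (h (t / b))) = ?D t / t"
  proof eventually_elim
    case (elim t)
    have "dist p (g (t / a)) = t" "dist p (h (t / b)) = t"
      using normalized_geodesicD(4)[OF geodesics_fromE[OF g(1)], of "t / a"]
        normalized_geodesicD(4)[OF geodesics_fromE[OF h(1)], of "t / b"] elim ab
      by (simp_all add: a_def b_def)
    \<comment> \<open>Law of cosines for an isosceles triangle with two sides of length
      \<open>t\<close>.\<close>
    then have "2 - 2 * comparison_cos p (g (t / a)) (h (t / b)) = (?D t / t)\<^sup>2"
      using elim by (simp add: comparison_cos_def field_simps power2_eq_square)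
    then show ?case
      using elim by simp
  qed
  with lim show ?thesis
    unfolding a_def b_def by (rule Lim_transform_eventually)
qed

text \<open>The chord limit determines the angle, since \<open>cos\<close> is injective on
  \<open>{0..pi}\<close>.\<close>

lemma alexandrov_angle_eqI:
  fixes p :: 'a
  assumes "g \<in> geodesics_from p" "zeta g = 1" "h \<in> geodesics_from p" "zeta h = 1"
    and "g' \<in> geodesics_from p" "zeta g' = 1" "h' \<in> geodesics_from p" "zeta h' = 1"
    and "sqrt (2 - 2 * cos (alexandrov_angle p g h)) = sqrt (2 - 2 * cos (alexandrov_angle p g' h'))"
  shows "alexandrov_angle p g h = alexandrov_angle p g' h'"
proof (rule cos_inj_pi)
  show "cos (alexandrov_angle p g h) = cos (alexandrov_angle p g' h')"
    using assms(9) by simp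
qed (use alexandrov_angle_bounds[OF assms(1-4)] alexandrov_angle_bounds[OF assms(5-8)] in auto)

text \<open>The chord length is symmetric in the two geodesics; zero geodesics are covered by the
  explicit value.\<close>

lemma alexandrov_angle_commute:
  fixes p :: 'a
  assumes g: "g \<in> geodesics_from p" and h: "h \<in> geodesics_from p"
  shows "alexandrov_angle p g h = alexandrov_angle p h g"
proof (cases "zeta g = 0 \<or> zeta h = 0")
  case True
  then show ?thesis
    using alexandrov_angle_zero[OF g h] alexandrov_angle_zero[OF h g] by auto
next
  case False
  then have z: "zeta g = 1" "zeta h = 1"
    using zeta_cases[of g] zeta_cases[of h] by auto
  have "((\<lambda>t. dist (g (t / dist p (g 1))) (h (t / dist p (h 1))) / t)
            \<longlongrightarrow> sqrt (2 - 2 * cos (alexandrov_angle p h g))) (at_right 0)"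
    using tendsto_chord[OF h z(2) g z(1)] by (simp add: dist_commute)
  then show ?thesis
    using tendsto_chord[OF g z(1) h z(2)] g h z
    by (intro alexandrov_angle_eqI tendsto_unique[of "at_right (0::real)"]) auto
qed

lemma alexandrov_angle_refl:
  fixes p :: 'a
  assumes g: "g \<in> geodesics_from p"
  shows "alexandrov_angle p g g = 0"
proof (cases "zeta g = 0")
  case True
  then show ?thesis
    using alexandrov_angle_zero[OF g g] by auto
next
  case False
  then have z: "zeta g = 1"
    using zeta_cases[of g] by auto
  have "sqrt (2 - 2 * cos (alexandrov_angle p g g)) = 0"
    using tendsto_chord[OF g z g z] by (intro tendsto_unique[of "at_right (0::real)"]) auto
  then have "cos (alexandrov_angle p g g) = cos 0"
    unfolding real_sqrt_eq_0_iff cos_zero by linarith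
  with alexandrov_angle_bounds[OF g z g z] show ?thesis
    by (metis atLeastAtMost_iff cos_inj_pi order_refl pi_ge_zero)
qed

text \<open>A zero and a nonzero geodesic meet at angle \<open>pi / 2\<close>.\<close>

lemma alexandrov_angle_0_imp_zeta_eq:
  assumes g: "g \<in> geodesics_from p" and h: "h \<in> geodesics_from p" and "alexandrov_angle p g h = 0"
  shows "zeta g = zeta h"
  using alexandrov_angle_zero[OF g h] assms(3) zeta_cases[of g] zeta_cases[of h]
  by (auto split: if_splits)

text \<open>Angle 0 makes the chord between \<open>g\<close> and \<open>g'\<close> of order
  \<open>o(t)\<close>. By the triangle inequality their chords to \<open>h\<close> differ by
  \<open>o(t)\<close>, so the chord limits agree.\<close>

lemma alexandrov_angle_cong_left:
  fixes p :: 'a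
  assumes g: "g \<in> geodesics_from p" and g': "g' \<in> geodesics_from p" and h: "h \<in> geodesics_from p"
    and 0: "alexandrov_angle p g g' = 0"
  shows "alexandrov_angle p g h = alexandrov_angle p g' h"
proof (cases "zeta g = 0 \<or> zeta h = 0")
  case True
  then show ?thesis
    using alexandrov_angle_0_imp_zeta_eq[OF g g' 0] alexandrov_angle_zero[OF g h]
      alexandrov_angle_zero[OF g' h] by auto
next
  case False
  then have z: "zeta g = 1" "zeta h = 1" "zeta g' = 1"
    using zeta_cases[of g] zeta_cases[of h] alexandrov_angle_0_imp_zeta_eq[OF g g' 0] by auto
  let ?g = "\<lambda>t. g (t / dist p (g 1))" and ?g' = "\<lambda>t. g' (t / dist p (g' 1))"
    and ?h = "\<lambda>t. h (t / dist p (h 1))"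
  have gg': "((\<lambda>t. dist (?g t) (?g' t) / t) \<longlongrightarrow> 0) (at_right 0)"
    using tendsto_chord[OF g z(1) g' z(3)] by (simp add: 0)
  have "((\<lambda>t. dist (?g t) (?h t) / t - dist (?g' t) (?h t) / t) \<longlongrightarrow> 0) (at_right 0)"
  proof (rule Lim_null_comparison[OF _ gg'])
    show "\<forall>\<^sub>F t in at_right 0. norm (dist (?g t) (?h t) / t - dist (?g' t) (?h t) / t)
        \<le> dist (?g t) (?g' t) / t"
      using eventually_at_right_0[OF zero_less_one]
    proof eventually_elim
      case (elim t)
      have "\<bar>dist (?g t) (?h t) - dist (?g' t) (?h t)\<bar> \<le> dist (?g t) (?g' t)"
        using abs_dist_diff_le[of "?g t" "?h t" "?g' t"] by (simp add: dist_commute)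
      then show ?case
        using elim by (simp add: divide_right_mono flip: diff_divide_distrib)
    qed
  qed
  moreover have "((\<lambda>t. dist (?g t) (?h t) / t - dist (?g' t) (?h t) / t)
      \<longlongrightarrow> sqrt (2 - 2 * cos (alexandrov_angle p g h)) - sqrt (2 - 2 * cos (alexandrov_angle p g' h)))
      (at_right 0)"
    by (intro tendsto_diff tendsto_chord g g' h z)
  ultimately have "sqrt (2 - 2 * cos (alexandrov_angle p g h)) -
      sqrt (2 - 2 * cos (alexandrov_angle p g' h)) = 0"
    by (intro tendsto_unique[of "at_right (0::real)"]) auto
  then show ?thesis
    using g g' h z by (intro alexandrov_angle_eqI) auto
qed

text \<open>Makes the angle between directions independent of representatives; the arguments are
  exchanged one at a time, with symmetry in between.\<close>

lemma alexandrov_angle_cong: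
  fixes p :: 'a
  assumes "(g, g') \<in> direction_rel p" "(h, h') \<in> direction_rel p"
  shows "alexandrov_angle p g h = alexandrov_angle p g' h'"
proof -
  have geo: "g \<in> geodesics_from p" "g' \<in> geodesics_from p" "h \<in> geodesics_from p" "h' \<in> geodesics_from p"
    and 0: "alexandrov_angle p g g' = 0" "alexandrov_angle p h h' = 0"
    using assms by (auto simp: direction_rel_def)
  have "alexandrov_angle p g h = alexandrov_angle p g' h"
    by (rule alexandrov_angle_cong_left[OF geo(1,2,3) 0(1)])
  also have "\<dots> = alexandrov_angle p h g'"
    by (rule alexandrov_angle_commute[OF geo(2,3)])
  also have "\<dots> = alexandrov_angle p h' g'"
    by (rule alexandrov_angle_cong_left[OF geo(3,4,2) 0(2)])
  also have "\<dots> = alexandrov_angle p g' h'"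
    by (rule alexandrov_angle_commute[OF geo(4,2)])
  finally show ?thesis .
qed

section \<open>Tangent spaces\<close>

text \<open>Transitivity is an instance of the congruence property: replacing \<open>g\<close> by
  \<open>h\<close> does not change the angle with \<open>k\<close>.\<close>

lemma equiv_direction_rel: "equiv (geodesics_from p) (direction_rel (p :: 'a))"
proof (rule equivI)
  show "direction_rel p \<subseteq> geodesics_from p \<times> geodesics_from p"
    by (auto simp: direction_rel_def)
  show "refl_on (geodesics_from p) (direction_rel p)"
    by (auto simp: refl_on_def direction_rel_def alexandrov_angle_refl)
  show "sym (direction_rel p)"
    unfolding sym_def direction_rel_def using alexandrov_angle_commute by fastforce
  show "trans (direction_rel p)"
  proof (rule transI)
    fix g h k assume "(g, h) \<in> direction_rel p" and hk: "(h, k) \<in> direction_rel p"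
    moreover from this have "(k, k) \<in> direction_rel p"
      by (auto simp: direction_rel_def alexandrov_angle_refl)
    ultimately show "(g, k) \<in> direction_rel p"
      using alexandrov_angle_cong[of g h p k k] by (auto simp: direction_rel_def)
  qed
qed

lemma direction_spaceE:
  assumes "c \<in> direction_space p"
  obtains g where "g \<in> geodesics_from p" "c = direction p g"
  using assms unfolding direction_space_def direction_def
  by (rule quotientE) (rule that[unfolded direction_def])

lemma direction_in_direction_space: "g \<in> geodesics_from p \<Longrightarrow> direction p g \<in> direction_space p"
  unfolding direction_space_def direction_def by (rule quotientI)

lemma mem_direction_self: "g \<in> geodesics_from (p :: 'a) \<Longrightarrow> g \<in> direction p g"
  unfolding direction_def by (rule equiv_class_self[OF equiv_direction_rel])

text \<open>Evaluates functions on equivalence classes at a representative, once they are known to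
  be constant on the class.\<close>

lemma the_elem_imageI:
  assumes "a \<in> S" "\<And>x. x \<in> S \<Longrightarrow> f x = f a"
  shows "the_elem (f ` S) = f a"
proof -
  have "f ` S \<subseteq> {f a}"
    using assms(2) by blast
  then have "f ` S = {f a}"
    using assms(1) by blast
  then show ?thesis
    by simp
qed

lemma direction_zeta_direction:
  fixes p :: 'a
  assumes "g \<in> geodesics_from p"
  shows "direction_zeta (direction p g) = zeta g"
  unfolding direction_zeta_def
proof (rule the_elem_imageI)
  show "g \<in> direction p g"
    by (rule mem_direction_self[OF assms])
  show "zeta h = zeta g" if "h \<in> direction p g" for h
    using that alexandrov_angle_0_imp_zeta_eq[of g p h] by (simp add: direction_def direction_rel_def)
qed

lemma direction_angle_direction:
  fixes p :: 'a
  assumes "g \<in> geodesics_from p" "h \<in> geodesics_from p"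
  shows "direction_angle p (direction p g) (direction p h) = alexandrov_angle p g h"
proof -
  have "the_elem ((\<lambda>(g, h). alexandrov_angle p g h) ` (direction p g \<times> direction p h))
      = (\<lambda>(g, h). alexandrov_angle p g h) (g, h)"
  proof (rule the_elem_imageI)
    show "(g, h) \<in> direction p g \<times> direction p h"
      using assms by (simp add: mem_direction_self)
    show "(case z of (g, h) \<Rightarrow> alexandrov_angle p g h) = (case (g, h) of (g, h) \<Rightarrow> alexandrov_angle p g h)"
      if "z \<in> direction p g \<times> direction p h" for z
      using that by (auto simp: direction_def alexandrov_angle_cong)
  qed
  then show ?thesis
    by (simp add: direction_angle_def)
qed

lemma direction_zeta_cases:
  fixes p :: 'a
  assumes "c \<in> direction_space p"
  shows "direction_zeta c = 0 \<or> direction_zeta c = 1"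
proof -
  obtain g where "g \<in> geodesics_from p" "c = direction p g"
    using assms by (rule direction_spaceE)
  then show ?thesis
    using zeta_cases[of g] by (simp add: direction_zeta_direction)
qed

text \<open>Reflexivity of \<open>tangent_rel\<close> holds because the length
  \<open>t * direction_zeta c\<close> is either zero or positive.\<close>

lemma mem_tangent_vector_self:
  fixes p :: 'a
  assumes "t \<ge> 0" "g \<in> geodesics_from p"
  shows "(t, direction p g) \<in> tangent_vector p t g"
proof -
  have "t * direction_zeta (direction p g) = 0 \<or> t * direction_zeta (direction p g) > 0"
    using assms(1) direction_zeta_cases[OF direction_in_direction_space[OF assms(2)]] by auto
  then show ?thesis
    using assms(1) direction_in_direction_space[OF assms(2)]
    by (simp add: tangent_vector_def tangent_rel_def)
qed

text \<open>Equivalent pairs share the length \<open>t * direction_zeta c\<close>, and also the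
  direction unless that length is 0, in which case the cosine is multiplied by 0.\<close>

lemma tangent_product_tangent_vector:
  fixes p :: 'a
  assumes "t1 \<ge> 0" "t2 \<ge> 0" and g: "g \<in> geodesics_from p" and h: "h \<in> geodesics_from p"
  shows "tangent_product p (tangent_vector p t1 g) (tangent_vector p t2 h) =
    t1 * t2 * zeta g * zeta h * cos (alexandrov_angle p g h)"
proof -
  let ?f = "\<lambda>((t1, c1), (t2, c2)).
       t1 * t2 * direction_zeta c1 * direction_zeta c2 * cos (direction_angle p c1 c2)"
  let ?z = "((t1, direction p g), (t2, direction p h))"
  have "the_elem (?f ` (tangent_vector p t1 g \<times> tangent_vector p t2 h)) = ?f ?z"
  proof (rule the_elem_imageI)
    show "?z \<in> tangent_vector p t1 g \<times> tangent_vector p t2 h"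
      using assms by (simp add: mem_tangent_vector_self)
    fix w assume w: "w \<in> tangent_vector p t1 g \<times> tangent_vector p t2 h"
    obtain s1 c1 s2 c2 where w_eq: "w = ((s1, c1), (s2, c2))"
      by (metis surj_pair)
    from w have 1: "t1 * direction_zeta (direction p g) = s1 * direction_zeta c1
        \<and> (s1 * direction_zeta c1 = 0 \<or> c1 = direction p g)"
      and 2: "t2 * direction_zeta (direction p h) = s2 * direction_zeta c2
        \<and> (s2 * direction_zeta c2 = 0 \<or> c2 = direction p h)"
      by (auto simp: w_eq tangent_vector_def tangent_rel_def)
    have "(s1 * direction_zeta c1) * (s2 * direction_zeta c2) * cos (direction_angle p c1 c2) =
      (t1 * direction_zeta (direction p g)) * (t2 * direction_zeta (direction p h)) *
        cos (direction_angle p (direction p g) (direction p h))"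
      using 1 2 by auto
    then show "?f w = ?f ?z"
      by (simp add: w_eq mult_ac)
  qed
  then show ?thesis
    using g h by (simp add: tangent_product_def direction_zeta_direction direction_angle_direction)
qed

lemma tangent_spaceE:
  assumes "\<eta> \<in> tangent_space p"
  obtains t g where "t \<ge> 0" "g \<in> geodesics_from p" "\<eta> = tangent_vector p t g"
proof -
  obtain z where "z \<in> {0..} \<times> direction_space p" "\<eta> = tangent_rel p `` {z}"
    using assms unfolding tangent_space_def by (rule quotientE)
  then obtain t c where "t \<ge> 0" "c \<in> direction_space p" "\<eta> = tangent_rel p `` {(t, c)}"
    by auto
  moreover from this(2) obtain g where "g \<in> geodesics_from p" "c = direction p g"
    by (rule direction_spaceE)
  ultimately show ?thesis
    using that by (simp add: tangent_vector_def)
qed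

text \<open>The coefficient of \<open>\<eta>\<close> serves as \<open>C\<close>, uniformly in
  \<open>h\<close>, as cosines are at least -1 and \<open>zeta\<close> takes only the values 0 and
  1.\<close>

lemma tangent_product_bounded_below:
  fixes p :: 'a
  assumes "\<eta> \<in> tangent_space p"
  obtains C where "C \<ge> 0" "\<And>h. h \<in> geodesics_from p \<Longrightarrow> - C \<le> tangent_product p \<eta> (tangent_vector p 1 h)"
proof -
  obtain t g where t: "t \<ge> 0" and g: "g \<in> geodesics_from p" and \<eta>: "\<eta> = tangent_vector p t g"
    using assms by (rule tangent_spaceE)
  have "- t \<le> tangent_product p \<eta> (tangent_vector p 1 h)" if h: "h \<in> geodesics_from p" for h
  proof -
    have "- t \<le> t * cos (alexandrov_angle p g h)"
      using mult_left_mono[OF cos_ge_minus_one t] by simp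
    then show ?thesis
      using zeta_cases[of g] zeta_cases[of h] t g h
      by (auto simp: \<eta> tangent_product_tangent_vector)
  qed
  with t show ?thesis
    by (rule that)
qed

section \<open>Resolvents\<close>

text \<open>The left side is \<open>2 * dist p x * dist p q\<close> times the comparison cosine,
  which is at most the cosine of the Alexandrov angle.\<close>

lemma first_variation_inequality:
  fixes p q x :: 'a
  shows "(dist p x)\<^sup>2 + (dist p q)\<^sup>2 - (dist q x)\<^sup>2 \<le> 2 * dist p q *
    tangent_product p (tangent_vector p (dist p x) (geod p x)) (tangent_vector p 1 (geod p q))"
proof (cases "x = p \<or> q = p")
  \<comment> \<open>In the degenerate cases both sides are 0.\<close>
  case True
  then show ?thesis
    using tangent_product_tangent_vector[OF _ _ geod_in_geodesics_from[of p x] geod_in_geodesics_from[of p q],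
        of "dist p x" 1] by (auto simp: dist_commute)
next
  case False
  have z: "zeta (geod p x) = 1" "zeta (geod p q) = 1"
    using False zeta_geodesic[OF geod_in_geodesics_from]
    by (auto simp: normalized_geodesicD(2)[OF normalized_geodesic_geod])
  have "comparison_cos p x q \<le> cos (alexandrov_angle p (geod p x) (geod p q))"
    using comparison_cos_le_cos_alexandrov_angle[OF geod_in_geodesics_from z(1) geod_in_geodesics_from z(2)]
    by (simp add: normalized_geodesicD(2)[OF normalized_geodesic_geod])
  then have "(dist p x)\<^sup>2 + (dist p q)\<^sup>2 - (dist q x)\<^sup>2 \<le>
      cos (alexandrov_angle p (geod p x) (geod p q)) * (2 * dist p x * dist p q)"
    using False by (subst pos_divide_le_eq[symmetric])
      (auto simp: comparison_cos_def dist_commute[of q x])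
  also have "\<dots> = 2 * dist p q * tangent_product p (tangent_vector p (dist p x) (geod p x))
      (tangent_vector p 1 (geod p q))"
    by (simp add: tangent_product_tangent_vector geod_in_geodesics_from z)
  finally show ?thesis .
qed

text \<open>Monotonicity against one fixed vector of \<open>A q\<close> bounds the product at
  \<open>p\<close> by a constant depending only on that vector; dividing by \<open>t\<close> and
  inserting the first variation inequality gives the estimate, uniformly in \<open>p\<close>,
  \<open>x\<close> and \<open>t\<close>.\<close>

lemma resolvent_estimate:
  fixes A :: "'a \<Rightarrow> 'a tangent set"
  assumes "vector_field A" "monotone_field A" "q \<in> field_dom A"
  obtains C where "C \<ge> 0"
    "\<And>p x t. t > 0 \<Longrightarrow> tangent_vector p (t * dist p x) (geod p x) \<in> A p \<Longrightarrow>
       (dist p x)\<^sup>2 + (dist p q)\<^sup>2 \<le> (dist q x)\<^sup>2 + 2 * (C / t) * dist p q"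
proof -
  obtain \<nu> where \<nu>: "\<nu> \<in> A q"
    using assms(3) by (auto simp: field_dom_def)
  then have "\<nu> \<in> tangent_space q"
    using assms(1) by (auto simp: vector_field_def)
  then obtain C where C: "C \<ge> 0"
    "\<And>h. h \<in> geodesics_from q \<Longrightarrow> - C \<le> tangent_product q \<nu> (tangent_vector q 1 h)"
    by (rule tangent_product_bounded_below) blast
  have "(dist p x)\<^sup>2 + (dist p q)\<^sup>2 \<le> (dist q x)\<^sup>2 + 2 * (C / t) * dist p q"
    if t: "t > 0" and p: "tangent_vector p (t * dist p x) (geod p x) \<in> A p" for p x t
  proof -
    let ?P = "\<lambda>s. tangent_product p (tangent_vector p s (geod p x)) (tangent_vector p 1 (geod p q))"
    have "?P (t * dist p x) \<le> - tangent_product q \<nu> (tangent_vector q 1 (geod q p))"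
      using assms(2) p \<nu> by (auto simp: monotone_field_def)
    also have "\<dots> \<le> C"
      using C(2)[OF geod_in_geodesics_from, of p] by simp
    also have "?P (t * dist p x) = t * ?P (dist p x)"
      using t by (simp add: tangent_product_tangent_vector geod_in_geodesics_from)
    finally have "?P (dist p x) \<le> C / t"
      using t by (simp add: field_simps)
    then have "2 * dist p q * ?P (dist p x) \<le> 2 * dist p q * (C / t)"
      by (intro mult_left_mono) auto
    then show ?thesis
      using first_variation_inequality[of p x q] by (simp add: mult_ac)
  qed
  with C(1) show ?thesis
    by (rule that)
qed

text \<open>Resolvent points of \<open>x\<close> lie in \<open>field_dom A\<close>, so it suffices
  to bring one of them within \<open>e\<close> of \<open>x\<close> by taking \<open>t\<close>
  large.\<close>

lemma geod_in_closure_field_dom: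
  fixes A :: "'a \<Rightarrow> 'a tangent set"
  assumes A: "vector_field A" "monotone_field A" "surjectivity_condition A"
    and q0: "q0 \<in> field_dom A" and q1: "q1 \<in> field_dom A" and u: "u \<in> {0..1}"
  shows "geod q0 q1 u \<in> closure (field_dom A)"
proof -
  define x where "x = geod q0 q1 u"
  note geod = normalized_geodesic_geod[of q0 q1]
  obtain C0 where C0: "C0 \<ge> 0"
    "\<And>p x t. t > 0 \<Longrightarrow> tangent_vector p (t * dist p x) (geod p x) \<in> A p \<Longrightarrow>
       (dist p x)\<^sup>2 + (dist p q0)\<^sup>2 \<le> (dist q0 x)\<^sup>2 + 2 * (C0 / t) * dist p q0"
    using resolvent_estimate[OF A(1,2) q0] by blast
  obtain C1 where C1: "C1 \<ge> 0"
    "\<And>p x t. t > 0 \<Longrightarrow> tangent_vector p (t * dist p x) (geod p x) \<in> A p \<Longrightarrow>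
       (dist p x)\<^sup>2 + (dist p q1)\<^sup>2 \<le> (dist q1 x)\<^sup>2 + 2 * (C1 / t) * dist p q1"
    using resolvent_estimate[OF A(1,2) q1] by blast
  define D where "D = dist q0 q1"
  have x: "dist q0 x = D * u" "dist q1 x = D * (1 - u)"
    using normalized_geodesicD(4,5)[OF geod u] by (auto simp: x_def D_def)
  have D: "D \<ge> 0"
    by (simp add: D_def)
  have "\<exists>p\<in>field_dom A. dist p x < e" if e: "e > 0" for e
  proof -
    \<comment> \<open>Chosen so that \<open>t * e\<close> exceeds
      \<open>(C0 + C1) * (1 + D / e)\<close>, which will contradict the estimate \<open>key\<close>
      if \<open>d \<ge> e\<close>; the summand 1 makes this strict and \<open>t\<close>
      positive.\<close>
    define t where "t = ((C0 + C1) * (1 + D / e) + 1) / e"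
    have t: "t > 0"
      using C0(1) C1(1) e D by (auto simp: t_def intro!: divide_pos_pos add_nonneg_pos)
    obtain p where p: "tangent_vector p (t * dist p x) (geod p x) \<in> A p"
      using A(3) t unfolding surjectivity_condition_def by blast
    define d where "d = dist p x"
    have d: "d \<ge> 0"
      by (simp add: d_def)
    \<comment> \<open>A common error bound for both endpoints, so that the two estimates can be
      averaged.\<close>
    have bound: "2 * (C / t) * dist p q \<le> 2 * ((C0 + C1) / t * (d + D))"
      if "0 \<le> C" "C \<le> C0 + C1" "dist q x \<le> D" for C q
    proof -
      have "dist p q \<le> d + D"
        using dist_triangle[of p q x] that by (simp add: d_def dist_commute)
      moreover have "C / t \<le> (C0 + C1) / t"
        using that t by (intro divide_right_mono) auto
      ultimately have "C / t * dist p q \<le> (C0 + C1) / t * (d + D)"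
        using that t C0(1) C1(1) by (intro mult_mono) auto
      then show ?thesis
        by simp
    qed
    have le: "D * u \<le> D" "D * (1 - u) \<le> D"
      using u D by (auto intro: mult_left_le)
    define K where "K = 2 * ((C0 + C1) / t * (d + D))"
    have 0: "d\<^sup>2 + (dist p q0)\<^sup>2 \<le> (D * u)\<^sup>2 + K"
      using C0(2)[OF t p] bound[of C0 q0] C0(1) C1(1) x le by (simp add: d_def K_def)
    have 1: "d\<^sup>2 + (dist p q1)\<^sup>2 \<le> (D * (1 - u))\<^sup>2 + K"
      using C1(2)[OF t p] bound[of C1 q1] C0(1) C1(1) x le by (simp add: d_def K_def)
    have CN: "d\<^sup>2 \<le> (1 - u) * (dist p q0)\<^sup>2 + u * (dist p q1)\<^sup>2 - u * (1 - u) * D\<^sup>2"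
      using CN_inequality[OF geod u, of p] by (simp add: d_def x_def D_def)
    \<comment> \<open>The weights are those of the CN inequality, so that the distances to
      \<open>q0\<close> and \<open>q1\<close> will cancel.\<close>
    have "(1 - u) * (d\<^sup>2 + (dist p q0)\<^sup>2) + u * (d\<^sup>2 + (dist p q1)\<^sup>2)
        \<le> (1 - u) * ((D * u)\<^sup>2 + K) + u * ((D * (1 - u))\<^sup>2 + K)"
      using u by (intro add_mono mult_left_mono[OF 0] mult_left_mono[OF 1]) auto
    also have "\<dots> = K + u * (1 - u) * D\<^sup>2"
      by (simp add: power2_eq_square algebra_simps)
    finally have "d\<^sup>2 + ((1 - u) * (dist p q0)\<^sup>2 + u * (dist p q1)\<^sup>2) \<le> K + u * (1 - u) * D\<^sup>2"
      by (simp add: algebra_simps)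
    \<comment> \<open>Adding the two inequalities leaves \<open>2 * d^2 \<le> K\<close>.\<close>
    with CN have "d\<^sup>2 \<le> (C0 + C1) / t * (d + D)"
      by (simp add: K_def)
    then have key: "t * d\<^sup>2 \<le> (C0 + C1) * (d + D)"
      using t by (simp add: field_simps)
    have "d < e"
    proof (rule ccontr)
      assume "\<not> d < e"
      then have de: "e \<le> d" by simp
      \<comment> \<open>From \<open>e \<le> d\<close> follows \<open>D \<le> (D / e) * d\<close>,
        which makes the right side of \<open>key\<close> linear in \<open>d\<close>, against a
        quadratic left side.\<close>
      have "(C0 + C1) * (d + D) \<le> (C0 + C1) * (1 + D / e) * d"
      proof -
        have "D * e \<le> D * d"
          using de D by (rule mult_left_mono)
        then have "d + D \<le> (1 + D / e) * d"
          using e by (simp add: field_simps)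
        then show ?thesis
          using C0(1) C1(1) by (simp add: mult_left_mono mult.assoc)
      qed
      also have "\<dots> < (t * e) * d"
        using e de by (intro mult_strict_right_mono) (auto simp: t_def)
      also have "\<dots> \<le> t * d\<^sup>2"
        using de d t by (simp add: power2_eq_square mult_left_mono mult_right_mono mult.assoc)
      finally show False
        using key by simp
    qed
    moreover have "p \<in> field_dom A"
      using p by (auto simp: field_dom_def)
    ultimately show ?thesis
      by (auto simp: d_def)
  qed
  then show ?thesis
    unfolding x_def[symmetric] by (simp add: closure_approachable)
qed

end

theorem proposition4p10:
  fixes A :: "'a::complete_space \<Rightarrow> 'a tangent set"
  assumes "CAT0_space TYPE('a)"
    and "geodesic_extension_property TYPE('a)"
    and "vector_field A"
    and "monotone_field A"
    and "surjectivity_condition A"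
  shows "geodesically_convex (closure (field_dom A))"
proof -
  interpret cat0 "TYPE('a)"
    using assms(1) by unfold_locales
  show ?thesis
    unfolding geodesically_convex_def
  proof (intro ballI image_subsetI)
    fix x y and u :: real
    assume "x \<in> closure (field_dom A)" "y \<in> closure (field_dom A)" and u: "u \<in> {0..1}"
    then obtain X Y where X: "\<And>n. X n \<in> field_dom A" "X \<longlonglongrightarrow> x"
      and Y: "\<And>n. Y n \<in> field_dom A" "Y \<longlonglongrightarrow> y"
      unfolding closure_sequential by blast
    \<comment> \<open>The geodesics between approximating points of the domain meet the closure at
      parameter \<open>u\<close>; continuity in the endpoints carries this to the limit.\<close>
    have "geod (X n) (Y n) u \<in> closure (field_dom A)" for n
      using assms(3-5) X(1) Y(1) u by (rule geod_in_closure_field_dom)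
    then show "geod x y u \<in> closure (field_dom A)"
      by (rule closed_sequentially[OF closed_closure _ tendsto_geod[OF X(2) Y(2) u]])
  qed
qed

end
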